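(* Let $I\sqcup\overline{J}$ be a partition of $[n]$ with $1\in I$ and $n\in\overline{J}$, and let $\nu$ be the lattice path associated with $(I,\overline J)$. Then covering $(I,\overline{J})$-forests are in bijection with $\nu$-Schröder trees.
   Context: Let $[n]=\{1,\dots,n\}$ with $n\ge 2$, and let $I\sqcup\overline J=[n]$ with $1\in I$, $n\in\overline J$. An $(I,\overline J)$-forest is a subgraph of the complete bipartite graph with parts $I$ and $\overline J$ that is increasing (each arc $(i,\overline j)$ with $i\in I$, $\overline j\in\overline J$ satisfies $i<\overline j$) and non-crossing (it does not contain two arcs $(i,\overline j)$ and $(i',\overline j')$ with $i<i'<\overline j<\overline j'$). A covering $(I,\overline J)$-forest is an $(I,\overline J)$-forest containing the arc $(1,n)$ and with no isolated nodes (every element of $[n]$ lies on some arc). The associated path $\nu$: label the $i$-th element of $I$ by $E_{i-1}$ and the $i$-th element of $\overline J$ by $N_{i-1}$; reading the labels of $k=2,\dots,n-1$ in increasing order gives a lattice path $\nu$, with east steps $E=(1,0)$ and north steps $N=(0,1)$, from $(0,0)$ to $(b,a)$ where $b=|I|-1$, $a=|\overline J|-1$. $R_\nu$ is the region weakly above $\nu$ inside the rectangle with corners $(0,0)$ and $(b,a)$. Two lattice points $p,q$ in $R_\nu$ are $\nu$-incompatible if $p$ is strictly southwest or strictly northeast of $q$ and the smallest rectangle containing $p$ and $q$ is contained in $R_\nu$; otherwise they are $\nu$-compatible. A $\nu$-Schröder tree is a set of pairwise $\nu$-compatible lattice points in $R_\nu$ which includes the point $(0,a)$ (the root) and such that each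 row and each column of the grid contains at least one point of the set. *)

theory Defs
  imports "HOL-Analysis.Analysis"
begin

section \<open>Forests\<close>

text \<open>A subgraph of the complete bipartite graph on the parts \<open>I\<close> and \<open>J\<close> is given by its set of
  arcs; the arc \<open>(i, j)\<close> has \<open>i \<in> I\<close> and \<open>j \<in> J\<close>. Its nodes are all of \<open>I \<union> J\<close>, so that a node
  on no arc is isolated.\<close>

definition increasing_arcs :: "(nat \<times> nat) set \<Rightarrow> bool" where
  "increasing_arcs F \<longleftrightarrow> (\<forall>(i, j) \<in> F. i < j)"

definition non_crossing :: "(nat \<times> nat) set \<Rightarrow> bool" where
  "non_crossing F \<longleftrightarrow>
     \<not> (\<exists>i j i' j'. (i, j) \<in> F \<and> (i', j') \<in> F \<and> i < i' \<and> i' < j \<and> j < j')"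

definition IJ_forest :: "nat set \<Rightarrow> nat set \<Rightarrow> (nat \<times> nat) set \<Rightarrow> bool" where
  "IJ_forest I J F \<longleftrightarrow> F \<subseteq> I \<times> J \<and> increasing_arcs F \<and> non_crossing F"

definition covering_forest :: "nat \<Rightarrow> nat set \<Rightarrow> nat set \<Rightarrow> (nat \<times> nat) set \<Rightarrow> bool" where
  "covering_forest n I J F \<longleftrightarrow>
     IJ_forest I J F \<and> (1, n) \<in> F \<and> (\<forall>k \<in> {1..n}. \<exists>(i, j) \<in> F. k = i \<or> k = j)"

section \<open>Lattice paths\<close>

datatype step = East | North

definition associated_path :: "nat \<Rightarrow> nat set \<Rightarrow> step list" where
  "associated_path n I = map (\<lambda>k. if k \<in> I then East else North) [2..<n]"

definition endpoint :: "step list \<Rightarrow> nat \<times> nat" where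
  "endpoint \<nu> = (count_list \<nu> East, count_list \<nu> North)"

lemma endpoint_associated_path:
  assumes "I \<union> J = {1..n}" "I \<inter> J = {}" "1 \<in> I" "n \<in> J"
  shows "endpoint (associated_path n I) = (card I - 1, card J - 1)"
proof -
  have count: "count_list (map f xs) c = card {k \<in> set xs. f k = c}"
    if "distinct xs" for f :: "nat \<Rightarrow> step" and xs c
    using that
  proof (induction xs)
    case (Cons x xs)
    then have "{k \<in> set (x # xs). f k = c} =
        (if f x = c then insert x {k \<in> set xs. f k = c} else {k \<in> set xs. f k = c})"
      by auto
    with Cons show ?case by simp
  qed simp
  have "k \<in> I \<union> J \<longleftrightarrow> 1 \<le> k \<and> k \<le> n" for k
    using assms(1) by simp
  then have mem: "k \<in> I \<or> k \<in> J \<longleftrightarrow> 1 \<le> k \<and> k \<le> n" for k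
    by simp
  have noteq: "k \<noteq> n" if "k \<in> I" for k using that assms by auto
  have noteq': "k \<noteq> 1" if "k \<in> J" for k using that assms by auto
  have I: "{k \<in> set [2..<n]. (if k \<in> I then East else North) = East} = I - {1}"
  proof (intro set_eqI)
    fix k
    show "k \<in> {k \<in> set [2..<n]. (if k \<in> I then East else North) = East} \<longleftrightarrow> k \<in> I - {1}"
      using mem[of k] noteq[of k] by (auto split: if_splits)
  qed
  have J: "{k \<in> set [2..<n]. (if k \<in> I then East else North) = North} = J - {n}"
  proof (intro set_eqI)
    fix k
    show "k \<in> {k \<in> set [2..<n]. (if k \<in> I then East else North) = North} \<longleftrightarrow> k \<in> J - {n}"
      using mem[of k] noteq'[of k] assms(2) by (auto split: if_splits)
  qed
  show ?thesis
    using assms(3,4)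
    by (simp only: endpoint_def associated_path_def count[OF distinct_upt] I J
        card_Diff_singleton)
qed

definition plane_point :: "nat \<times> nat \<Rightarrow> real \<times> real" where
  "plane_point p = (real (fst p), real (snd p))"

text \<open>The path as a curve in the plane; inserting the origin matters only for the empty path.\<close>

definition path_curve :: "step list \<Rightarrow> (real \<times> real) set" where
  "path_curve \<nu> = insert (0, 0)
     (\<Union>k < length \<nu>. closed_segment (plane_point (endpoint (take k \<nu>)))
                                       (plane_point (endpoint (take (Suc k) \<nu>))))"

definition region :: "step list \<Rightarrow> (real \<times> real) set" where
  "region \<nu> = {(x, y). 0 \<le> x \<and> x \<le> real (fst (endpoint \<nu>)) \<and>
                       0 \<le> y \<and> y \<le> real (snd (endpoint \<nu>)) \<and>
                       (\<exists>y' \<le> y. (x, y') \<in> path_curve \<nu>)}"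

text \<open>All lattice points of the region have natural number coordinates.\<close>

definition region_points :: "step list \<Rightarrow> (nat \<times> nat) set" where
  "region_points \<nu> = {p. plane_point p \<in> region \<nu>}"

section \<open>Schroeder trees\<close>

definition strictly_southwest :: "nat \<times> nat \<Rightarrow> nat \<times> nat \<Rightarrow> bool" where
  "strictly_southwest p q \<longleftrightarrow> fst p < fst q \<and> snd p < snd q"

definition bounding_rectangle :: "real \<times> real \<Rightarrow> real \<times> real \<Rightarrow> (real \<times> real) set" where
  "bounding_rectangle p q =
     {min (fst p) (fst q) .. max (fst p) (fst q)} \<times> {min (snd p) (snd q) .. max (snd p) (snd q)}"

definition incompatible :: "step list \<Rightarrow> nat \<times> nat \<Rightarrow> nat \<times> nat \<Rightarrow> bool" where
  "incompatible \<nu> p q \<longleftrightarrow>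
     (strictly_southwest p q \<or> strictly_southwest q p) \<and>
     bounding_rectangle (plane_point p) (plane_point q) \<subseteq> region \<nu>"

definition schroeder_tree :: "step list \<Rightarrow> (nat \<times> nat) set \<Rightarrow> bool" where
  "schroeder_tree \<nu> T \<longleftrightarrow>
     T \<subseteq> region_points \<nu> \<and>
     (\<forall>p \<in> T. \<forall>q \<in> T. \<not> incompatible \<nu> p q) \<and>
     (0, snd (endpoint \<nu>)) \<in> T \<and>
     (\<forall>y \<le> snd (endpoint \<nu>). \<exists>x. (x, y) \<in> T) \<and>
     (\<forall>x \<le> fst (endpoint \<nu>). \<exists>y. (x, y) \<in> T)"

end

theory Submission
  imports Defs
begin

text \<open>Send an arc \<open>(i, j)\<close> to the lattice point whose coordinates are the positions of \<open>i\<close> in \<open>I\<close> and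
  of \<open>j\<close> in \<open>J\<close>. The point lies weakly above the path iff \<open>i < j\<close>. As the region is closed under moving
  left and up, a rectangle lies in it iff its south-east corner does; for two arcs with \<open>i < i'\<close> and
  \<open>j < j'\<close> this corner is the image of \<open>(i', j)\<close>, so incompatibility is exactly crossing.\<close>

text \<open>The rank of \<open>k\<close> in \<open>A\<close>, counted from 0 like the labels of the
  path. It makes sense for every \<open>k\<close>, so that elements outside \<open>A\<close> can
  serve as thresholds.\<close>

definition position :: "nat set \<Rightarrow> nat \<Rightarrow> nat" where
  "position A k = card (A \<inter> {..<k})"

lemma position_mono: "k \<le> l \<Longrightarrow> position A k \<le> position A l"
  unfolding position_def by (intro card_mono) auto

lemma position_less_iff:
  assumes "k \<in> A"
  shows "position A k < position A l \<longleftrightarrow> k < l"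
proof
  assume "k < l"
  with assms have "A \<inter> {..<k} \<subset> A \<inter> {..<l}" by auto
  then show "position A k < position A l"
    unfolding position_def by (intro psubset_card_mono) auto
qed (use position_mono[of l k A] in force)

text \<open>Ranks increase strictly along \<open>A\<close>, hence are distinct, and stay below
  \<open>card A\<close> because an element does not count itself; equal cardinalities then give
  surjectivity.\<close>

lemma bij_betw_position:
  assumes "finite A"
  shows "bij_betw (position A) A {..<card A}"
proof -
  have inj: "inj_on (position A) A"
    by (intro inj_onI) (metis nat_neq_iff position_less_iff)
  have "position A ` A \<subseteq> {..<card A}"
    unfolding position_def using assms by (auto intro!: psubset_card_mono)
  moreover have "card (position A ` A) = card {..<card A}"
    using inj by (simp add: card_image)
  ultimately show ?thesis
    using inj by (simp add: bij_betw_def card_subset_eq)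
qed

lemma endpoint_take_Suc:
  assumes "k < length \<nu>"
  shows "endpoint (take (Suc k) \<nu>) =
    (case \<nu> ! k of East \<Rightarrow> (Suc (fst (endpoint (take k \<nu>))), snd (endpoint (take k \<nu>)))
     | North \<Rightarrow> (fst (endpoint (take k \<nu>)), Suc (snd (endpoint (take k \<nu>)))))"
  using assms by (auto simp: endpoint_def take_Suc_conv_app_nth split: step.split)

lemma closed_segment_Pair_same_snd:
  fixes a b c :: real
  assumes "a \<le> b"
  shows "(x, y) \<in> closed_segment (a, c) (b, c) \<longleftrightarrow> a \<le> x \<and> x \<le> b \<and> y = c"
proof -
  have "(x, y) \<in> closed_segment (a, c) (b, c) \<longleftrightarrow> x \<in> closed_segment a b \<and> y = c"
    by (auto simp: closed_segment_def algebra_simps)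
  then show ?thesis
    using assms by (auto simp: closed_segment_eq_real_ivl)
qed

lemma closed_segment_Pair_same_fst:
  fixes a b c :: real
  assumes "a \<le> b"
  shows "(x, y) \<in> closed_segment (c, a) (c, b) \<longleftrightarrow> a \<le> y \<and> y \<le> b \<and> x = c"
proof -
  have "(x, y) \<in> closed_segment (c, a) (c, b) \<longleftrightarrow> y \<in> closed_segment a b \<and> x = c"
    by (auto simp: closed_segment_def algebra_simps)
  then show ?thesis
    using assms by (auto simp: closed_segment_eq_real_ivl)
qed

text \<open>Each point of the curve has a vertex of the path weakly to its south-east: the right end
  of an east step, or the lower end of a north step. This reduces the curve to its finitely many
  vertices.\<close>

lemma path_curve_below_iff:
  fixes x y :: real
  assumes "0 \<le> x" "0 \<le> y"
  shows "(\<exists>y' \<le> y. (x, y') \<in> path_curve \<nu>) \<longleftrightarrow>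
    (\<exists>k \<le> length \<nu>. x \<le> real (fst (endpoint (take k \<nu>))) \<and> real (snd (endpoint (take k \<nu>))) \<le> y)"
    (is "?L \<longleftrightarrow> (\<exists>k \<le> _. ?P k)")
proof
  assume ?L
  then obtain y' where y': "y' \<le> y" "(x, y') \<in> path_curve \<nu>" by blast
  then consider "(x, y') = (0, 0)"
    | k where "k < length \<nu>" "(x, y') \<in> closed_segment (plane_point (endpoint (take k \<nu>)))
                                       (plane_point (endpoint (take (Suc k) \<nu>)))"
    unfolding path_curve_def by blast
  then show "\<exists>k \<le> length \<nu>. ?P k"
  proof cases
    case 1
    with assms have "?P 0" by (simp add: endpoint_def)
    then show ?thesis by blast
  next
    case (2 k)
    show ?thesis
    proof (cases "\<nu> ! k")
      case East
      with 2 y' have "?P (Suc k)"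
        by (simp add: endpoint_take_Suc plane_point_def closed_segment_Pair_same_snd)
      with 2 show ?thesis by (meson Suc_leI)
    next
      case North
      with 2 y' have "?P k"
        by (simp add: endpoint_take_Suc plane_point_def closed_segment_Pair_same_fst)
      with 2 show ?thesis by (meson less_imp_le)
    qed
  qed
next
  let ?Q = "\<lambda>k. k \<le> length \<nu> \<and> ?P k"
  assume "\<exists>k \<le> length \<nu>. ?P k"
  \<comment> \<open>\<open>k\<close> indexes the first vertex weakly south-east of the point
    \<open>(x, y)\<close>.\<close>
  then obtain k where k: "?Q k" and least: "\<And>m. m < k \<Longrightarrow> \<not> ?Q m"
    using exists_least_iff[of ?Q] by blast
  show ?L
  proof (cases k)
    case 0
    with k assms have "(x, 0) \<in> path_curve \<nu>"
      by (simp add: endpoint_def path_curve_def)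
    with assms show ?thesis by blast
  next
    case (Suc m)
    with k have m: "m < length \<nu>" by simp
    from least[of m] Suc m have notP: "\<not> ?P m" by simp
    \<comment> \<open>A north step only raises the height, so the vertex before it would already
      qualify.\<close>
    have East: "\<nu> ! m = East"
      using k notP m Suc by (cases "\<nu> ! m") (auto simp: endpoint_take_Suc)
    \<comment> \<open>Both ends of the step have the same height, at most \<open>y\<close>. So the
      earlier vertex fails by lying left of \<open>x\<close>, and the step passes over
      \<open>x\<close>.\<close>
    with k notP m Suc
    have "(x, real (snd (endpoint (take k \<nu>)))) \<in> closed_segment (plane_point (endpoint (take m \<nu>)))
                                       (plane_point (endpoint (take (Suc m) \<nu>)))"
      by (simp add: endpoint_take_Suc plane_point_def closed_segment_Pair_same_snd)
    with m have "(x, real (snd (endpoint (take k \<nu>)))) \<in> path_curve \<nu>"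
      unfolding path_curve_def by blast
    with k show ?thesis by blast
  qed
qed

text \<open>Closure to the left and upwards inside the box becomes visible in this form: a vertex
  remains a witness when \<open>x\<close> decreases or \<open>y\<close> increases.\<close>

lemma region_iff:
  "(x, y) \<in> region \<nu> \<longleftrightarrow>
     0 \<le> x \<and> x \<le> real (fst (endpoint \<nu>)) \<and> 0 \<le> y \<and> y \<le> real (snd (endpoint \<nu>)) \<and>
     (\<exists>k \<le> length \<nu>. x \<le> real (fst (endpoint (take k \<nu>))) \<and> real (snd (endpoint (take k \<nu>))) \<le> y)"
  using path_curve_below_iff[of x y \<nu>] by (auto simp: region_def)

lemma region_points_iff:
  "(x, y) \<in> region_points \<nu> \<longleftrightarrow>
     x \<le> fst (endpoint \<nu>) \<and> y \<le> snd (endpoint \<nu>) \<and>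
     (\<exists>k \<le> length \<nu>. x \<le> fst (endpoint (take k \<nu>)) \<and> snd (endpoint (take k \<nu>)) \<le> y)"
  by (simp add: region_points_def plane_point_def region_iff)

text \<open>A vertex weakly south-east of the corner \<open>(fst q, snd p)\<close> is weakly
  south-east of every point of the rectangle.\<close>

lemma incompatible_iff:
  assumes "p \<in> region_points \<nu>" "q \<in> region_points \<nu>" "strictly_southwest p q"
  shows "incompatible \<nu> p q \<longleftrightarrow> (fst q, snd p) \<in> region_points \<nu>"
proof -
  obtain x y x' y' where pq: "p = (x, y)" "q = (x', y')" by (metis surj_pair)
  with assms have less: "x < x'" "y < y'"
    by (auto simp: strictly_southwest_def)
  have rect: "bounding_rectangle (plane_point p) (plane_point q) = {real x..real x'} \<times> {real y..real y'}"
    using less by (simp add: bounding_rectangle_def plane_point_def pq)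
  have "{real x..real x'} \<times> {real y..real y'} \<subseteq> region \<nu> \<longleftrightarrow> (real x', real y) \<in> region \<nu>"
  proof
    assume "(real x', real y) \<in> region \<nu>"
    then obtain k where k: "k \<le> length \<nu>" "real x' \<le> real (fst (endpoint (take k \<nu>)))"
        "real (snd (endpoint (take k \<nu>))) \<le> real y"
      unfolding region_iff by blast
    \<comment> \<open>The north-east corner \<open>q\<close> supplies the upper bounds for the whole
      rectangle.\<close>
    have bounds: "x' \<le> fst (endpoint \<nu>)" "y' \<le> snd (endpoint \<nu>)"
      using assms(2) by (auto simp: pq region_points_iff)
    have "(u, v) \<in> region \<nu>" if "real x \<le> u" "u \<le> real x'" "real y \<le> v" "v \<le> real y'" for u v
      unfolding region_iff
    proof (intro conjI exI[of _ k])
      show "u \<le> real (fst (endpoint \<nu>))" "v \<le> real (snd (endpoint \<nu>))"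
        using that bounds by linarith+
    qed (use that k in linarith)+
    then show "{real x..real x'} \<times> {real y..real y'} \<subseteq> region \<nu>" by auto
  qed (use less in auto)
  with assms(3) show ?thesis
    by (simp add: incompatible_def rect) (simp add: pq region_points_def plane_point_def)
qed

lemma incompatible_commute: "incompatible \<nu> p q \<longleftrightarrow> incompatible \<nu> q p"
  by (auto simp: incompatible_def bounding_rectangle_def min.commute max.commute)

text \<open>Incompatibility is symmetric, so it suffices to test pairs with \<open>p\<close>
  strictly southwest of \<open>q\<close>.\<close>

lemma pairwise_compatible_iff:
  assumes "T \<subseteq> region_points \<nu>"
  shows "(\<forall>p \<in> T. \<forall>q \<in> T. \<not> incompatible \<nu> p q) \<longleftrightarrow>
    (\<forall>p \<in> T. \<forall>q \<in> T. strictly_southwest p q \<longrightarrow> (fst q, snd p) \<notin> region_points \<nu>)"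
proof -
  have "strictly_southwest p q \<or> strictly_southwest q p" if "incompatible \<nu> p q" for p q
    using that by (simp add: incompatible_def)
  then show ?thesis
    by (meson assms incompatible_commute incompatible_iff subsetD)
qed

text \<open>The letter with index \<open>k\<close>, counted from 0, belongs to the element
  \<open>2 + k\<close>.\<close>

lemma endpoint_take_associated_path:
  assumes "k \<le> n - 2"
  shows "endpoint (take k (associated_path n I)) = (card (I \<inter> {2..<2 + k}), card ({2..<2 + k} - I))"
  using assms
proof (induction k)
  case (Suc k)
  then have k: "k < length (associated_path n I)" "associated_path n I ! k = (if 2 + k \<in> I then East else North)"
    by (auto simp: associated_path_def)
  have "{2..<2 + Suc k} = insert (2 + k) {2..<2 + k}" by auto
  then have "I \<inter> {2..<2 + Suc k} = (if 2 + k \<in> I then insert (2 + k) (I \<inter> {2..<2 + k}) else I \<inter> {2..<2 + k})"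
    "{2..<2 + Suc k} - I = (if 2 + k \<in> I then {2..<2 + k} - I else insert (2 + k) ({2..<2 + k} - I))"
    by auto
  with Suc k show ?case
    by (simp only: endpoint_take_Suc) (simp add: card_insert_if)
qed (simp add: endpoint_def)

text \<open>The prefix of length \<open>k\<close> ends at a vertex weakly south-east of the image of
  \<open>(i, j)\<close> iff \<open>i < 2 + k\<close> and \<open>2 + k \<le> j\<close>; a threshold
  \<open>2 + k\<close> of this kind exists iff \<open>i < j\<close>.\<close>

lemma position_region_points_iff:
  assumes IJ: "I \<union> J = {1..n}" "I \<inter> J = {}" "1 \<in> I" "n \<in> J" and ij: "i \<in> I" "j \<in> J"
  shows "(position I i, position J j) \<in> region_points (associated_path n I) \<longleftrightarrow> i < j"
proof -
  have mem: "k \<in> I \<or> k \<in> J \<longleftrightarrow> 1 \<le> k \<and> k \<le> n" for k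
    using IJ(1) by (metis Un_iff atLeastAtMost_iff)
  have fin: "finite I" "finite J"
    using IJ(1) by (metis finite_Un finite_atLeastAtMost)+
  have "i \<noteq> n" "j \<noteq> 1" using ij IJ by auto
  with mem ij have i: "1 \<le> i" "i < n" and j: "1 < j" "j \<le> n"
    by (metis le_neq_implies_less)+
  \<comment> \<open>The element 1 lies in \<open>I\<close> but has no letter. This shifts the count
    by one and later turns a weak inequality into a strict one.\<close>
  have east: "position I (2 + k) = Suc (card (I \<inter> {2..<2 + k}))" for k
  proof -
    have "I \<inter> {..<2 + k} = insert 1 (I \<inter> {2..<2 + k})"
    proof (intro set_eqI)
      fix l show "l \<in> I \<inter> {..<2 + k} \<longleftrightarrow> l \<in> insert 1 (I \<inter> {2..<2 + k})"
        using mem[of l] IJ(3) by auto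
    qed
    then show ?thesis by (simp add: position_def)
  qed
  \<comment> \<open>No shift occurs here: 1 is not in \<open>J\<close>, and \<open>2 + k\<close>
    does not exceed \<open>n\<close>.\<close>
  have north: "position J (2 + k) = card ({2..<2 + k} - I)" if "k \<le> n - 2" for k
  proof -
    have "J \<inter> {..<2 + k} = {2..<2 + k} - I"
    proof (intro set_eqI)
      fix l show "l \<in> J \<inter> {..<2 + k} \<longleftrightarrow> l \<in> {2..<2 + k} - I"
        using mem[of l] IJ(2,3) that i by (cases "l = 1") auto
    qed
    then show ?thesis by (simp add: position_def)
  qed
  have len: "length (associated_path n I) = n - 2"
    by (simp add: associated_path_def)
  have prefix: "x \<le> fst (endpoint (take k (associated_path n I))) \<and>
      snd (endpoint (take k (associated_path n I))) \<le> y \<longleftrightarrow>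
      x < position I (2 + k) \<and> position J (2 + k) \<le> y" if "k \<le> n - 2" for x y k
    by (simp only: endpoint_take_associated_path[OF that] east north[OF that] fst_conv snd_conv less_Suc_eq_le)
  have "position I i < card I" "position J j < card J"
    using bij_betw_position fin ij by (auto dest!: bij_betwE)
  then have "position I i \<le> card I - 1" "position J j \<le> card J - 1" by linarith+
  then have "(position I i, position J j) \<in> region_points (associated_path n I) \<longleftrightarrow>
      (\<exists>k \<le> n - 2. position I i < position I (2 + k) \<and> position J (2 + k) \<le> position J j)"
    by (simp add: region_points_iff endpoint_associated_path[OF IJ] len prefix del: One_nat_def cong: conj_cong)
  \<comment> \<open>As \<open>i\<close> lies in \<open>I\<close> and \<open>j\<close> in
    \<open>J\<close>, their ranks compare with that of \<open>2 + k\<close> as the elements do,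
    whichever set contains \<open>2 + k\<close>.\<close>
  also have "\<dots> \<longleftrightarrow> (\<exists>k \<le> n - 2. i < 2 + k \<and> 2 + k \<le> j)"
    using position_less_iff[of i I] position_less_iff[of j J] ij by (metis not_le)
  also have "\<dots> \<longleftrightarrow> i < j"
  proof
    assume "i < j"
    \<comment> \<open>The witness \<open>i - 1\<close> gives the threshold
      \<open>i + 1\<close>.\<close>
    then show "\<exists>k \<le> n - 2. i < 2 + k \<and> 2 + k \<le> j"
      using i j by (intro exI[of _ "i - 1"]) auto
  qed auto
  finally show ?thesis .
qed

text \<open>The conditions match one by one: region with increasing arcs, compatibility with
  non-crossing, root with the arc \<open>(1, n)\<close>, rows and columns with the absence of
  isolated nodes.\<close>

lemma schroeder_tree_position_image_iff:
  assumes IJ: "I \<union> J = {1..n}" "I \<inter> J = {}" "1 \<in> I" "n \<in> J" and F: "F \<subseteq> I \<times> J"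
  shows "schroeder_tree (associated_path n I) (map_prod (position I) (position J) ` F) \<longleftrightarrow> covering_forest n I J F"
proof -
  let ?\<nu> = "associated_path n I" and ?T = "map_prod (position I) (position J) ` F"
  have fin: "finite I" "finite J"
    using IJ(1) by (metis finite_Un finite_atLeastAtMost)+
  note I = bij_betw_position[OF fin(1)] and J = bij_betw_position[OF fin(2)]
  note point = position_region_points_iff[OF IJ]
  have FI: "i \<in> I" and FJ: "j \<in> J" if "(i, j) \<in> F" for i j
    using that F by auto
  have cards: "card I > 0" "card J > 0"
    using IJ fin by (auto simp: card_gt_0_iff)
  have increasing: "?T \<subseteq> region_points ?\<nu> \<longleftrightarrow> increasing_arcs F"
    unfolding increasing_arcs_def using FI FJ point by fastforce
  have crossing: "(\<forall>p \<in> ?T. \<forall>q \<in> ?T. \<not> incompatible ?\<nu> p q) \<longleftrightarrow> non_crossing F"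
    if "?T \<subseteq> region_points ?\<nu>"
  proof -
    \<comment> \<open>The corner comes from the pair \<open>(i', j)\<close>, so its membership in
      the region is the middle inequality \<open>i' < j\<close> of a crossing.\<close>
    have "(strictly_southwest (position I i, position J j) (position I i', position J j') \<and>
        (position I i', position J j) \<in> region_points ?\<nu>) \<longleftrightarrow> i < i' \<and> i' < j \<and> j < j'"
      if "(i, j) \<in> F" "(i', j') \<in> F" for i j i' j'
      using that FI FJ by (auto simp: strictly_southwest_def position_less_iff point)
    then have "(\<forall>(i, j) \<in> F. \<forall>(i', j') \<in> F.
        strictly_southwest (position I i, position J j) (position I i', position J j') \<longrightarrow>
        (position I i', position J j) \<notin> region_points ?\<nu>) \<longleftrightarrow> non_crossing F"
      unfolding non_crossing_def by blast
    then show ?thesis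
      unfolding pairwise_compatible_iff[OF that] by (simp add: case_prod_beta strictly_southwest_def)
  qed
  have one: "position I 1 = 0"
  proof -
    have "I \<inter> {..<1} = {}" using IJ(1) by force
    then show ?thesis by (simp add: position_def)
  qed
  have last: "position J n = card J - 1"
  proof -
    have "J \<subseteq> {1..n}" using IJ(1) by blast
    then have "J \<inter> {..<n} = J - {n}" by force
    then show ?thesis using IJ(4) by (simp add: position_def)
  qed
  have inj: "inj_on (map_prod (position I) (position J)) (I \<times> J)"
    using I J by (simp add: bij_betw_def map_prod_inj_on)
  \<comment> \<open>By injectivity, \<open>(1, n)\<close> is the only pair in
    \<open>I \<times> J\<close> sent to the root.\<close>
  have root: "(0, card J - 1) \<in> ?T \<longleftrightarrow> (1, n) \<in> F"
    using inj_on_image_mem_iff[OF inj _ F, of "(1, n)"] IJ(3,4) by (simp add: one last del: One_nat_def)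
  have rows: "(\<forall>y \<le> card J - 1. \<exists>x. (x, y) \<in> ?T) \<longleftrightarrow> (\<forall>j \<in> J. \<exists>i. (i, j) \<in> F)"
  proof -
    \<comment> \<open>The row indices are exactly the ranks of the elements of
      \<open>J\<close>.\<close>
    have "(\<forall>y \<le> card J - 1. \<exists>x. (x, y) \<in> ?T) \<longleftrightarrow> (\<forall>y \<in> position J ` J. \<exists>x. (x, y) \<in> ?T)"
      using cards by (auto simp: bij_betw_imp_surj_on[OF J])
    also have "\<dots> \<longleftrightarrow> (\<forall>j \<in> J. \<exists>i. (i, j) \<in> F)"
    proof (intro iffI ballI)
      fix j assume *: "\<forall>y \<in> position J ` J. \<exists>x. (x, y) \<in> ?T" "j \<in> J"
      then obtain i' j' where F': "(i', j') \<in> F" "position J j = position J j'"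
        by fastforce
      with * have "j' = j"
        using inj_onD[OF bij_betw_imp_inj_on[OF J]] FJ by metis
      with F' show "\<exists>i. (i, j) \<in> F" by blast
    qed force
    finally show ?thesis .
  qed
  have columns: "(\<forall>x \<le> card I - 1. \<exists>y. (x, y) \<in> ?T) \<longleftrightarrow> (\<forall>i \<in> I. \<exists>j. (i, j) \<in> F)"
  proof -
    have "(\<forall>x \<le> card I - 1. \<exists>y. (x, y) \<in> ?T) \<longleftrightarrow> (\<forall>x \<in> position I ` I. \<exists>y. (x, y) \<in> ?T)"
      using cards by (auto simp: bij_betw_imp_surj_on[OF I])
    also have "\<dots> \<longleftrightarrow> (\<forall>i \<in> I. \<exists>j. (i, j) \<in> F)"
    proof (intro iffI ballI)
      fix i assume *: "\<forall>x \<in> position I ` I. \<exists>y. (x, y) \<in> ?T" "i \<in> I"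
      then obtain i' j' where F': "(i', j') \<in> F" "position I i = position I i'"
        by fastforce
      with * have "i' = i"
        using inj_onD[OF bij_betw_imp_inj_on[OF I]] FI by metis
      with F' show "\<exists>j. (i, j) \<in> F" by blast
    qed force
    finally show ?thesis .
  qed
  \<comment> \<open>Since \<open>I\<close> and \<open>J\<close> are disjoint, an element of
    \<open>I\<close> can be covered only as a left end of an arc and an element of \<open>J\<close>
    only as a right end.\<close>
  have covering: "(\<forall>k \<in> {1..n}. \<exists>(i, j) \<in> F. k = i \<or> k = j) \<longleftrightarrow>
      (\<forall>j \<in> J. \<exists>i. (i, j) \<in> F) \<and> (\<forall>i \<in> I. \<exists>j. (i, j) \<in> F)"
    unfolding IJ(1)[symmetric] using FI FJ IJ(2) by blast
  show ?thesis
    unfolding schroeder_tree_def covering_forest_def IJ_forest_def endpoint_associated_path[OF IJ]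
      fst_conv snd_conv root rows columns covering
    using F increasing crossing by blast
qed

theorem theorem4p2:
  fixes n :: nat and I J :: "nat set"
  assumes "2 \<le> n"
    and "I \<union> J = {1..n}"
    and "I \<inter> J = {}"
    and "1 \<in> I"
    and "n \<in> J"
  shows "\<exists>f. bij_betw f {F. covering_forest n I J F} {T. schroeder_tree (associated_path n I) T}"
proof -
  let ?g = "map_prod (position I) (position J)" and ?B = "{..<card I} \<times> {..<card J}"
  have fin: "finite I" "finite J"
    using assms(2) by (metis finite_Un finite_atLeastAtMost)+
  have bij: "bij_betw ?g (I \<times> J) ?B"
    using bij_betw_position fin by (intro bij_betw_map_prod)
  have cards: "card I > 0" "card J > 0"
    using assms fin by (auto simp: card_gt_0_iff)
  \<comment> \<open>The bijection from \<open>I \<times> J\<close> to the grid acts on subsets, and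
    the equivalence for images restricts it to forests and trees.\<close>
  have "bij_betw ((`) ?g) {F \<in> Pow (I \<times> J). covering_forest n I J F}
      {T \<in> Pow ?B. schroeder_tree (associated_path n I) T}"
    using assms by (intro bij_betw_Collect bij_betw_Pow[OF bij] schroeder_tree_position_image_iff) auto
  moreover have "{F \<in> Pow (I \<times> J). covering_forest n I J F} = {F. covering_forest n I J F}"
    by (auto simp: covering_forest_def IJ_forest_def)
  \<comment> \<open>Every tree lies in the grid, so restricting to its power set loses none.\<close>
  moreover have "region_points (associated_path n I) \<subseteq> ?B"
    using cards by (auto simp: region_points_iff endpoint_associated_path[OF assms(2-5)])
  then have "{T \<in> Pow ?B. schroeder_tree (associated_path n I) T} = {T. schroeder_tree (associated_path n I) T}"
    by (auto simp: schroeder_tree_def)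
  ultimately show ?thesis by auto
qed

end
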